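(* Let $\mu$ be a positive Borel measure on $[0,1)$. Then the following conditions are equivalent: (i) $\int_{[0,1)}\log\frac{2}{1-t}\,d\mu(t)<\infty$. (ii) For any given $s\in(0,\infty)$ and any $f\in Q_s$, the integral $\int_{[0,1)}\frac{f(t)}{1-tz}\,d\mu(t)$ converges for all $z\in\mathbb D$ and the resulting function $I_\mu(f)$ of $z$ is analytic in $\mathbb D$.
   Context: $\mathbb D=\{z\in\mathbb C:|z|<1\}$, and $dA(z)=\frac{dx\,dy}{\pi}$ is the normalized area measure on $\mathbb D$. For $0\le s<\infty$, $Q_s$ is the set of analytic functions $f$ in $\mathbb D$ with $\|f\|_{Q_s}=\left(|f(0)|^2+\rho_{Q_s}(f)^2\right)^{1/2}<\infty$, where $\rho_{Q_s}(f)=\left(\sup_{a\in\mathbb D}\int_{\mathbb D}|f'(z)|^2g(z,a)^s\,dA(z)\right)^{1/2}$ and $g(z,a)=\log\left|\frac{1-\overline a z}{z-a}\right|$ is the Green's function of $\mathbb D$. For an analytic function $f$ in $\mathbb D$, $I_\mu(f)(z)=\int_{[0,1)}\frac{f(t)}{1-tz}\,d\mu(t)$ whenever the right-hand side makes sense and defines an analytic function in $\mathbb D$. *)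

theory Defs
  imports "HOL-Complex_Analysis.Complex_Analysis"
begin

abbreviation unit_disc :: "complex set" where
  "unit_disc \<equiv> ball 0 1"

definition area_measure :: "complex measure" where
  "area_measure = scale_measure (ennreal (1 / pi)) (restrict_space lborel unit_disc)"

text \<open>At \<open>z = a\<close> the Green's function is \<open>+\<infinity>\<close>, while here it gets the junk value
  \<open>ln 0 = 0\<close>. It is only ever integrated over \<open>z\<close> against the area measure, for which single
  points are null.\<close>

definition green_disc :: "complex \<Rightarrow> complex \<Rightarrow> real" where
  "green_disc z a = ln (cmod ((1 - cnj a * z) / (z - a)))"

definition ennreal_sqrt :: "ennreal \<Rightarrow> ennreal" where
  "ennreal_sqrt x = (if x = \<infinity> then \<infinity> else ennreal (sqrt (enn2real x)))"

definition rho_Q :: "real \<Rightarrow> (complex \<Rightarrow> complex) \<Rightarrow> ennreal" where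
  "rho_Q s f = ennreal_sqrt
     (SUP a\<in>unit_disc. \<integral>\<^sup>+ z. ennreal ((cmod (deriv f z))\<^sup>2 * green_disc z a powr s) \<partial>area_measure)"

definition norm_Q :: "real \<Rightarrow> (complex \<Rightarrow> complex) \<Rightarrow> ennreal" where
  "norm_Q s f = ennreal_sqrt (ennreal ((cmod (f 0))\<^sup>2) + (rho_Q s f)\<^sup>2)"

text \<open>Functions on the disc are represented by total functions; their values outside the disc
  play no role.\<close>

definition Q_space :: "real \<Rightarrow> (complex \<Rightarrow> complex) set" where
  "Q_space s = {f. f analytic_on unit_disc \<and> norm_Q s f < \<infinity>}"

text \<open>The measure has space \<open>[0,1)\<close> (see \<open>borel_measure_01\<close>), so integrating over the whole
  measure is integrating over \<open>[0,1)\<close>.\<close>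

definition I_integrand :: "(complex \<Rightarrow> complex) \<Rightarrow> complex \<Rightarrow> real \<Rightarrow> complex" where
  "I_integrand f z t = f (of_real t) / (1 - of_real t * z)"

definition I_op :: "real measure \<Rightarrow> (complex \<Rightarrow> complex) \<Rightarrow> complex \<Rightarrow> complex" where
  "I_op M f z = (LINT t|M. I_integrand f z t)"

definition borel_measure_01 :: "real measure \<Rightarrow> bool" where
  "borel_measure_01 M \<longleftrightarrow> sets M = sets (restrict_space borel {0..<1})"

end

theory Submission
  imports Defs
begin

text \<open>
  Condition (i) is what controls a function of logarithmic growth, and the functions of \<open>Q\<^sub>s\<close> grow at
  most, and in one case exactly, logarithmically along the radius \<open>[0,1)\<close>.

  From (i) to (ii): on the Euclidean disc of radius \<open>(1 - |a|)/2\<close> about \<open>a\<close> the Green's function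
  with pole \<open>a\<close> is at least \<open>ln 2\<close>, so the \<open>Q\<^sub>s\<close> seminorm bounds the area integral of \<open>|f'|\<^sup>2\<close> over
  this disc. By the area mean value inequality \<open>|f'(a)|\<close> is \<open>O(1 / (1 - |a|))\<close>, that is, \<open>Q\<^sub>s\<close> lies
  in the Bloch space (\<open>Q_space_imp_Bloch\<close>). Integrating along the radius gives
  \<open>|f(t)| \<le> K ln (2 / (1 - t))\<close> (\<open>Bloch_log_growth\<close>), so \<open>t \<mapsto> f(t)\<close> is \<open>\<mu>\<close>-integrable by (i). The
  Cauchy transform of an integrable function on \<open>[0,1)\<close> is given by the power series of its moments
  (\<open>analytic_Cauchy_transform\<close>).

  From (ii) to (i): the function \<open>ln (2 / (1 - z))\<close> belongs to \<open>Q\<^sub>2\<close> (\<open>log_in_Q_space_2\<close>), and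
  integrability of the integrand at the single point \<open>z = 0\<close> is then condition (i). Membership in
  \<open>Q\<^sub>2\<close> is usually read off from the equality of \<open>Q\<^sub>2\<close> with the Bloch space. Here the integrand is
  instead dominated, uniformly in the pole \<open>a\<close>, by a dilated and translated copy of a fixed
  integrable product \<open>k(x) k(y)\<close>; as the dilations preserve the integral, only the finiteness of one
  real integral remains.

  The area mean value inequality is the average over all radii of the mean value property on circles.
  Instead of polar coordinates, the argument uses that Lebesgue measure on the complex plane is
  invariant under rotation, which follows by writing a rotation as a product of three shears.
\<close>

section \<open>Rotation invariance of plane Lebesgue measure\<close>

lemma measurable_Complex_pair [measurable]:
  "(\<lambda>p. Complex (fst p) (snd p)) \<in> borel_measurable (borel \<Otimes>\<^sub>M borel)"
  unfolding Complex_eq by measurable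

lemma lborel_complex_eq_distr:
  "(lborel :: complex measure) = distr (lborel \<Otimes>\<^sub>M lborel) borel (\<lambda>p. Complex (fst p) (snd p))"
proof (rule lborel_eqI)
  fix l u :: complex
  assume lu: "\<And>b. b \<in> Basis \<Longrightarrow> l \<bullet> b \<le> u \<bullet> b"
  from lu[of 1] lu[of \<i>] have le: "Re l \<le> Re u" "Im l \<le> Im u"
    by (auto simp: Basis_complex_def)
  have "(\<lambda>p. Complex (fst p) (snd p)) -` box l u \<inter> space (lborel \<Otimes>\<^sub>M lborel)
      = {Re l<..<Re u} \<times> {Im l<..<Im u}"
    by (auto simp: box_def Basis_complex_def space_pair_measure)
  then have "emeasure (distr (lborel \<Otimes>\<^sub>M lborel) borel (\<lambda>p. Complex (fst p) (snd p))) (box l u)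
      = emeasure (lborel \<Otimes>\<^sub>M lborel) ({Re l<..<Re u} \<times> {Im l<..<Im u})"
    by (subst emeasure_distr) (auto simp: measurable_Complex_pair)
  also have "\<dots> = ennreal (Re u - Re l) * ennreal (Im u - Im l)"
    using le by (simp add: lborel.emeasure_pair_measure_Times)
  also have "\<dots> = ennreal (\<Prod>b\<in>Basis. (u - l) \<bullet> b)"
    using le by (simp add: Basis_complex_def ennreal_mult'')
  finally show "emeasure (distr (lborel \<Otimes>\<^sub>M lborel) borel (\<lambda>p. Complex (fst p) (snd p))) (box l u)
      = ennreal (\<Prod>b\<in>Basis. (u - l) \<bullet> b)" .
qed simp

lemma nn_integral_lborel_complex:
  assumes [measurable]: "f \<in> borel_measurable borel"
  shows "(\<integral>\<^sup>+z. f z \<partial>lborel) = (\<integral>\<^sup>+x. \<integral>\<^sup>+y. f (Complex x y) \<partial>lborel \<partial>lborel)"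
    and "(\<integral>\<^sup>+z. f z \<partial>lborel) = (\<integral>\<^sup>+y. \<integral>\<^sup>+x. f (Complex x y) \<partial>lborel \<partial>lborel)"
proof -
  have m: "(\<lambda>p. f (Complex (fst p) (snd p))) \<in> borel_measurable (lborel \<Otimes>\<^sub>M lborel)"
    by measurable
  have eq: "(\<integral>\<^sup>+z. f z \<partial>lborel) = (\<integral>\<^sup>+p. f (Complex (fst p) (snd p)) \<partial>(lborel \<Otimes>\<^sub>M lborel))"
    by (subst lborel_complex_eq_distr, subst nn_integral_distr) auto
  show "(\<integral>\<^sup>+z. f z \<partial>lborel) = (\<integral>\<^sup>+x. \<integral>\<^sup>+y. f (Complex x y) \<partial>lborel \<partial>lborel)"
    using lborel.nn_integral_fst[OF m] by (simp add: eq)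
  show "(\<integral>\<^sup>+z. f z \<partial>lborel) = (\<integral>\<^sup>+y. \<integral>\<^sup>+x. f (Complex x y) \<partial>lborel \<partial>lborel)"
    using lborel_pair.nn_integral_snd[OF m] by (simp add: eq)
qed

text \<open>
  Fubini: on each line along which the shear acts it is a translation.
\<close>

lemma nn_integral_lborel_shear:
  fixes c :: real
  assumes [measurable]: "f \<in> borel_measurable borel"
  shows "(\<integral>\<^sup>+z. f (Complex (Re z + c * Im z) (Im z)) \<partial>lborel) = (\<integral>\<^sup>+z. f z \<partial>lborel)"
    and "(\<integral>\<^sup>+z. f (Complex (Re z) (Im z + c * Re z)) \<partial>lborel) = (\<integral>\<^sup>+z. f z \<partial>lborel)"
proof -
  have m: "(\<lambda>z. f (Complex (Re z + c * Im z) (Im z))) \<in> borel_measurable borel"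
    "(\<lambda>z. f (Complex (Re z) (Im z + c * Re z))) \<in> borel_measurable borel"
    unfolding Complex_eq by measurable
  have m': "(\<lambda>x. f (Complex x y)) \<in> borel_measurable borel"
    "(\<lambda>x. f (Complex y x)) \<in> borel_measurable borel" for y
    unfolding Complex_eq by measurable
  have "(\<integral>\<^sup>+x. f (Complex (x + c * y) y) \<partial>lborel) = (\<integral>\<^sup>+x. f (Complex x y) \<partial>lborel)" for y
    using nn_integral_real_affine[OF m'(1)[of y], of 1 "c * y"] by (simp add: add.commute)
  then show "(\<integral>\<^sup>+z. f (Complex (Re z + c * Im z) (Im z)) \<partial>lborel) = (\<integral>\<^sup>+z. f z \<partial>lborel)"
    unfolding nn_integral_lborel_complex(2)[OF assms] nn_integral_lborel_complex(2)[OF m(1)]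
    by simp
  have "(\<integral>\<^sup>+y. f (Complex x (y + c * x)) \<partial>lborel) = (\<integral>\<^sup>+y. f (Complex x y) \<partial>lborel)" for x
    using nn_integral_real_affine[OF m'(2)[of x], of 1 "c * x"] by (simp add: add.commute)
  then show "(\<integral>\<^sup>+z. f (Complex (Re z) (Im z + c * Re z)) \<partial>lborel) = (\<integral>\<^sup>+z. f z \<partial>lborel)"
    unfolding nn_integral_lborel_complex(1)[OF assms] nn_integral_lborel_complex(1)[OF m(2)]
    by simp
qed

text \<open>
  Apart from the half turn, a rotation by an angle \<open>\<theta>\<close> is a product of three shears, with parameters
  \<open>-tan(\<theta>/2)\<close>, \<open>sin \<theta>\<close> and \<open>-tan(\<theta>/2)\<close>, each of which preserves the measure. The half turn is the
  square of the quarter turn.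
\<close>

lemma nn_integral_lborel_rotate:
  assumes [measurable]: "f \<in> borel_measurable borel" and u: "cmod u = 1"
  shows "(\<integral>\<^sup>+z. f (u * z) \<partial>lborel) = (\<integral>\<^sup>+z. f z \<partial>lborel)"
proof -
  have main: "(\<integral>\<^sup>+z. g (w * z) \<partial>lborel) = (\<integral>\<^sup>+z. g z \<partial>lborel)"
    if w: "cmod w = 1" "w \<noteq> -1" and g[measurable]: "g \<in> borel_measurable borel" for w g
  proof -
    define c s where "c = Re w" and "s = Im w"
    \<comment> \<open>the tangent of half the rotation angle, which is why the half turn is excluded\<close>
    define t where "t = s / (1 + c)"
    have cs: "c\<^sup>2 + s\<^sup>2 = 1"
      using w by (simp add: c_def s_def cmod_def)
    have c1: "1 + c \<noteq> 0"
    proof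
      assume "1 + c = 0"
      then have "c = -1" by simp
      with cs have "s = 0" by simp
      with \<open>c = -1\<close> w(2) show False by (simp add: c_def s_def complex_eq_iff)
    qed
    have ts: "t * s = 1 - c"
    proof -
      have "s * s = (1 - c) * (1 + c)" using cs by (simp add: power2_eq_square algebra_simps)
      then show ?thesis using c1 by (simp add: t_def field_simps)
    qed
    have tc: "t * c = s - t" using c1 by (simp add: t_def field_simps)
    define A where "A = (\<lambda>z. Complex (Re z + (- t) * Im z) (Im z))"
    define B where "B = (\<lambda>z. Complex (Re z) (Im z + s * Re z))"
    have mA[measurable]: "A \<in> borel_measurable borel" and mB[measurable]: "B \<in> borel_measurable borel"
      unfolding A_def B_def Complex_eq by measurable
    have rot: "w * z = A (B (A z))" for z
    proof -
      have e: "Re (A (B (A z))) = (1 - t * s) * Re z - (2 * t - t * (t * s)) * Im z"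
        by (simp add: A_def B_def algebra_simps)
      have e': "Im (A (B (A z))) = s * Re z + (1 - t * s) * Im z"
        by (simp add: A_def B_def algebra_simps)
      have "1 - t * s = c" using ts by simp
      moreover have "2 * t - t * (t * s) = s" unfolding ts using tc by (simp add: algebra_simps)
      ultimately show ?thesis using e e' by (simp add: complex_eq_iff c_def s_def)
    qed
    have shear_A: "(\<integral>\<^sup>+z. h (A z) \<partial>lborel) = (\<integral>\<^sup>+z. h z \<partial>lborel)"
      if "h \<in> borel_measurable borel" for h :: "complex \<Rightarrow> ennreal"
      using nn_integral_lborel_shear(1)[OF that, of "-t"] by (simp add: A_def)
    have shear_B: "(\<integral>\<^sup>+z. h (B z) \<partial>lborel) = (\<integral>\<^sup>+z. h z \<partial>lborel)"
      if "h \<in> borel_measurable borel" for h :: "complex \<Rightarrow> ennreal"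
      using nn_integral_lborel_shear(2)[OF that, of s] by (simp add: B_def)
    have "(\<integral>\<^sup>+z. g (w * z) \<partial>lborel) = (\<integral>\<^sup>+z. g (A (B (A z))) \<partial>lborel)"
      by (simp add: rot)
    also have "\<dots> = (\<integral>\<^sup>+z. g (A (B z)) \<partial>lborel)"
      by (rule shear_A[of "\<lambda>z. g (A (B z))"]) measurable
    also have "\<dots> = (\<integral>\<^sup>+z. g (A z) \<partial>lborel)"
      by (rule shear_B[of "\<lambda>z. g (A z)"]) measurable
    also have "\<dots> = (\<integral>\<^sup>+z. g z \<partial>lborel)"
      by (rule shear_A[OF g])
    finally show ?thesis .
  qed
  show ?thesis
  proof (cases "u = -1")
    case True
    have "(\<integral>\<^sup>+z. f (u * z) \<partial>lborel) = (\<integral>\<^sup>+z. f (\<i> * (\<i> * z)) \<partial>lborel)"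
      by (simp add: True mult.assoc[symmetric])
    also have "\<dots> = (\<integral>\<^sup>+z. f (\<i> * z) \<partial>lborel)"
      using main[of \<i> "\<lambda>z. f (\<i> * z)"] by (simp add: complex_eq_iff)
    also have "\<dots> = (\<integral>\<^sup>+z. f z \<partial>lborel)"
      using main[of \<i> f] by (simp add: complex_eq_iff)
    finally show ?thesis .
  qed (use u main in simp)
qed

section \<open>The area mean value inequality\<close>

text \<open>
  Cauchy's integral formula at the centre of the unit circle.
\<close>

lemma has_integral_circle_mean:
  fixes H :: "complex \<Rightarrow> complex"
  assumes "H holomorphic_on cball 0 1"
  shows "((\<lambda>t. H (cis t)) has_integral 2 * pi * H 0) {0..2 * pi}"
proof -
  have "((\<lambda>u. H u / (u - 0)) has_contour_integral 2 * of_real pi * \<i> * H 0) (circlepath 0 1)"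
    by (rule Cauchy_integral_circlepath_simple[OF assms]) simp
  then have "((\<lambda>t. H (cis t) * \<i>) has_integral 2 * pi * \<i> * H 0) {0..2 * pi}"
    unfolding circlepath_def
    by (subst (asm) has_contour_integral_part_circlepath_iff) auto
  from has_integral_mult_right[OF this, of "- \<i>"] show ?thesis
    by (simp add: mult_ac)
qed

text \<open>
  Stated with the nonnegative integral so that it can be integrated over the radius by Tonelli.
  It is the mean value property of the holomorphic function \<open>H\<^sup>2\<close>.
\<close>

lemma cmod_square_le_circle_mean:
  assumes "H holomorphic_on cball 0 1"
  shows "ennreal (2 * pi * (cmod (H 0))\<^sup>2)
    \<le> (\<integral>\<^sup>+t. ennreal ((cmod (H (cis t)))\<^sup>2) * indicator {0..2 * pi} t \<partial>lborel)"
proof -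
  define F where "F = (\<lambda>t. indicator {0..2 * pi} t *\<^sub>R (H (cis t))\<^sup>2)"
  have "(\<lambda>w. (H w)\<^sup>2) holomorphic_on cball 0 1"
    using assms by (intro holomorphic_intros)
  from has_integral_circle_mean[OF this]
  have I: "((\<lambda>t. (H (cis t))\<^sup>2) has_integral 2 * pi * (H 0)\<^sup>2) {0..2 * pi}" .
  have "continuous_on {0..2 * pi} (\<lambda>t. (H (cis t))\<^sup>2)"
    by (intro continuous_intros continuous_on_compose2[OF holomorphic_on_imp_continuous_on[OF assms]]) auto
  then have si: "set_integrable lborel {0..2 * pi} (\<lambda>t. (H (cis t))\<^sup>2)"
    by (rule borel_integrable_atLeastAtMost')
  then have int: "integrable lborel F"
    by (simp add: set_integrable_def F_def)
  have "integral\<^sup>L lborel F = 2 * pi * (H 0)\<^sup>2"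
    using set_borel_integral_eq_integral(2)[OF si] I
    by (simp add: set_lebesgue_integral_def F_def integral_unique)
  then have "ennreal (2 * pi * (cmod (H 0))\<^sup>2) = ennreal (norm (integral\<^sup>L lborel F))"
    by (simp add: norm_mult norm_power)
  also have "\<dots> \<le> (\<integral>\<^sup>+t. norm (F t) \<partial>lborel)"
    by (rule integral_norm_bound_ennreal[OF int])
  also have "\<dots> = (\<integral>\<^sup>+t. ennreal ((cmod (H (cis t)))\<^sup>2) * indicator {0..2 * pi} t \<partial>lborel)"
    by (intro nn_integral_cong) (auto simp: F_def norm_power split: split_indicator)
  finally show ?thesis .
qed

text \<open>
  Rotating the disc does not change the integral, so the integral equals its own average over all
  rotations. Interchanging the two integrals, the inner one becomes the integral of \<open>|h|\<^sup>2\<close> over a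
  circle centred at \<open>a\<close>, to which the inequality on circles applies.
\<close>

lemma cmod_square_le_disc_mean:
  assumes h: "h holomorphic_on ball a r" and r: "0 < r"
  shows "ennreal (pi * r\<^sup>2 * (cmod (h a))\<^sup>2)
    \<le> (\<integral>\<^sup>+z. ennreal ((cmod (h z))\<^sup>2) * indicator (ball a r) z \<partial>lborel)"
proof -
  define G0 where "G0 = (\<lambda>z. ennreal ((cmod (h z))\<^sup>2) * indicator (ball a r) z)"
  define G where "G = (\<lambda>z. G0 (a + z))"
  have "(\<lambda>z. indicator (ball a r) z *\<^sub>R ((cmod (h z))\<^sup>2)) \<in> borel_measurable borel"
    by (intro borel_measurable_continuous_on_indicator continuous_intros
        holomorphic_on_imp_continuous_on[OF h]) auto
  then have "(\<lambda>z. ennreal (indicator (ball a r) z *\<^sub>R ((cmod (h z))\<^sup>2))) \<in> borel_measurable borel"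
    by measurable
  also have "(\<lambda>z. ennreal (indicator (ball a r) z *\<^sub>R ((cmod (h z))\<^sup>2))) = G0"
    by (auto simp: G0_def fun_eq_iff split: split_indicator)
  finally have [measurable]: "G0 \<in> borel_measurable borel" .
  have [measurable]: "G \<in> borel_measurable borel"
    unfolding G_def by measurable
  have N: "(\<integral>\<^sup>+z. G0 z \<partial>lborel) = (\<integral>\<^sup>+z. G z \<partial>lborel)"
    unfolding G_def by (subst lborel_distr_plus[of a, symmetric], subst nn_integral_distr) auto
  have [measurable]: "cis \<in> borel_measurable borel"
    by (intro borel_measurable_continuous_onI continuous_intros)
  have pt: "ennreal (2 * pi * (cmod (h a))\<^sup>2) * indicator (ball 0 r) z
      \<le> (\<integral>\<^sup>+t. G (cis t * z) * indicator {0..2 * pi} t \<partial>lborel)" for z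
  proof (cases "z \<in> ball 0 r")
    case True
    \<comment> \<open>\<open>H\<close> maps the unit circle to the circle about \<open>a\<close> through \<open>a + z\<close>.\<close>
    define H where "H = (\<lambda>w. h (a + w * z))"
    have sub: "cmod (w * z) < r" if "w \<in> cball 0 1" for w
      using that True mult_right_mono[of "cmod w" 1 "cmod z"] by (auto simp: norm_mult)
    have "H holomorphic_on cball 0 1"
      unfolding H_def using sub
      by (intro holomorphic_on_compose_gen[OF _ h, unfolded o_def] holomorphic_intros)
         (auto simp: dist_norm)
    from cmod_square_le_circle_mean[OF this]
    have "ennreal (2 * pi * (cmod (h a))\<^sup>2)
      \<le> (\<integral>\<^sup>+t. ennreal ((cmod (h (a + cis t * z)))\<^sup>2) * indicator {0..2 * pi} t \<partial>lborel)"
      by (simp add: H_def)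
    also have "\<dots> = (\<integral>\<^sup>+t. G (cis t * z) * indicator {0..2 * pi} t \<partial>lborel)"
      using True by (intro nn_integral_cong) (auto simp: G_def G0_def dist_norm norm_mult)
    finally show ?thesis
      using True by simp
  qed simp
  have "ennreal (2 * pi) * ennreal (pi * r\<^sup>2 * (cmod (h a))\<^sup>2)
      = ennreal (2 * pi * (cmod (h a))\<^sup>2) * emeasure lborel (ball (0::complex) r)"
    using r by (simp add: emeasure_ball unit_ball_vol_2 ennreal_mult'' [symmetric] mult_ac
        flip: ennreal_mult)
  also have "\<dots> = (\<integral>\<^sup>+z. ennreal (2 * pi * (cmod (h a))\<^sup>2) * indicator (ball (0::complex) r) z \<partial>lborel)"
    by (rule nn_integral_cmult_indicator[symmetric]) simp
  also have "\<dots> \<le> (\<integral>\<^sup>+z. (\<integral>\<^sup>+t. G (cis t * z) * indicator {0..2 * pi} t \<partial>lborel) \<partial>lborel)"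
    by (intro nn_integral_mono pt)
  also have "\<dots> = (\<integral>\<^sup>+t. (\<integral>\<^sup>+z. G (cis t * z) * indicator {0..2 * pi} t \<partial>lborel) \<partial>lborel)"
    by (rule lborel_pair.Fubini') measurable
  also have "\<dots> = (\<integral>\<^sup>+t. (\<integral>\<^sup>+z. G z \<partial>lborel) * indicator {0..2 * pi} t \<partial>lborel)"
    by (intro nn_integral_cong) (simp add: nn_integral_multc nn_integral_lborel_rotate)
  also have "\<dots> = ennreal (2 * pi) * (\<integral>\<^sup>+z. G z \<partial>lborel)"
    by (subst nn_integral_cmult_indicator) (auto simp: mult.commute)
  finally have "ennreal (pi * r\<^sup>2 * (cmod (h a))\<^sup>2) \<le> (\<integral>\<^sup>+z. G z \<partial>lborel)"
    by (subst (asm) ennreal_mult_le_mult_iff) auto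
  then show ?thesis
    by (simp add: N[symmetric] G0_def)
qed

section \<open>Functions in the Q spaces have logarithmic growth\<close>

lemma nn_integral_area_measure:
  assumes "f \<in> borel_measurable (restrict_space borel unit_disc)"
  shows "(\<integral>\<^sup>+z. f z \<partial>area_measure) = ennreal (1 / pi) * (\<integral>\<^sup>+z. f z * indicator unit_disc z \<partial>lborel)"
proof -
  have "f \<in> borel_measurable (restrict_space lborel unit_disc)"
    using assms by (simp cong: measurable_cong_sets restrict_space_sets_cong)
  then show ?thesis
    by (simp add: area_measure_def nn_integral_scale_measure nn_integral_restrict_space)
qed

lemma Q_integrand_measurable:
  assumes "f analytic_on unit_disc"
  shows "(\<lambda>z. ennreal ((cmod (deriv f z))\<^sup>2 * green_disc z a powr s))
    \<in> borel_measurable (restrict_space borel unit_disc)"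
proof -
  have "deriv f holomorphic_on unit_disc"
    using assms by (simp add: analytic_on_open holomorphic_deriv)
  then have [measurable]: "deriv f \<in> borel_measurable (restrict_space borel unit_disc)"
    by (intro borel_measurable_continuous_on_restrict holomorphic_on_imp_continuous_on)
  have "(\<lambda>z. green_disc z a) \<in> borel_measurable borel"
    unfolding green_disc_def by measurable
  then have [measurable]: "(\<lambda>z. green_disc z a) \<in> borel_measurable (restrict_space borel unit_disc)"
    by (rule measurable_restrict_space1)
  show ?thesis
    by measurable
qed

lemma ennreal_sqrt_less_top_iff: "ennreal_sqrt x < \<infinity> \<longleftrightarrow> x < \<infinity>"
  by (auto simp: ennreal_sqrt_def less_top)

text \<open>
  Both square roots and the term \<open>|f(0)|\<^sup>2\<close> preserve finiteness and infinity.
\<close>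

lemma Q_space_iff:
  "f \<in> Q_space s \<longleftrightarrow> f analytic_on unit_disc \<and>
    (SUP a\<in>unit_disc. \<integral>\<^sup>+z. ennreal ((cmod (deriv f z))\<^sup>2 * green_disc z a powr s) \<partial>area_measure) < \<infinity>"
proof -
  have "norm_Q s f < \<infinity> \<longleftrightarrow> rho_Q s f < \<infinity>"
    unfolding norm_Q_def ennreal_sqrt_less_top_iff
    by (auto simp: power2_eq_square ennreal_mult_less_top)
  then show ?thesis
    unfolding Q_space_def mem_Collect_eq rho_Q_def ennreal_sqrt_less_top_iff by (rule conj_cong[OF refl])
qed

lemma cmod_one_minus_cnj_mult_ge:
  assumes "cmod a < 1" "cmod z < 1"
  shows "1 - cmod a \<le> cmod (1 - cnj a * z)"
proof -
  have "cmod (cnj a * z) \<le> cmod a"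
    using assms by (simp add: norm_mult mult_left_le)
  then show ?thesis
    using norm_triangle_ineq2[of 1 "cnj a * z"] by simp
qed

text \<open>
  On this disc the pseudohyperbolic distance to the pole is at most one half. The point \<open>z = a\<close> has to be
  left out, since there \<open>green_disc\<close> takes the value \<open>0\<close>.
\<close>

lemma green_disc_ge_ln2:
  assumes a: "cmod a < 1" and z: "cmod (z - a) < (1 - cmod a) / 2" "z \<noteq> a"
  shows "ln 2 \<le> green_disc z a"
proof -
  have "cmod z < 1"
    using norm_triangle_ineq[of "z - a" a] a z(1) by simp
  from cmod_one_minus_cnj_mult_ge[OF a this] have "2 * cmod (z - a) \<le> cmod (1 - cnj a * z)"
    using z(1) by simp
  then have "2 \<le> cmod ((1 - cnj a * z) / (z - a))"
    using z(2) by (simp add: norm_divide pos_le_divide_eq)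
  then show ?thesis
    unfolding green_disc_def by (subst ln_le_cancel_iff) auto
qed

text \<open>
  The seminorm dominates a fixed multiple of the area integral of \<open>|f'|\<^sup>2\<close> over the disc of radius
  \<open>(1 - |a|)/2\<close> about \<open>a\<close>, which in turn dominates \<open>(1 - |a|)\<^sup>2 |f'(a)|\<^sup>2\<close> by the area mean value
  inequality.
\<close>

lemma Q_space_imp_Bloch:
  assumes f: "f \<in> Q_space s" and s: "0 < s"
  obtains C where "0 \<le> C" "\<And>a. a \<in> unit_disc \<Longrightarrow> cmod (deriv f a) \<le> C / (1 - cmod a)"
proof -
  define J where "J = (\<lambda>a. \<integral>\<^sup>+z. ennreal ((cmod (deriv f z))\<^sup>2 * green_disc z a powr s) \<partial>area_measure)"
  define S where "S = enn2real (SUP a\<in>unit_disc. J a)"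
  define c where "c = ln 2 powr s"
  have c: "0 < c" by (simp add: c_def)
  from f have an: "f analytic_on unit_disc" and fin: "(SUP a\<in>unit_disc. J a) < \<infinity>"
    by (auto simp: Q_space_iff J_def)
  have J_le: "J a \<le> ennreal S" if "a \<in> unit_disc" for a
    using SUP_upper[of a unit_disc J] that fin by (simp add: S_def less_top)
  have bound: "cmod (deriv f a) \<le> sqrt (4 * S / c) / (1 - cmod a)" if a: "a \<in> unit_disc" for a
  proof -
    define r where "r = (1 - cmod a) / 2"
    have r: "0 < r" using a by (simp add: r_def)
    have sub: "ball a r \<subseteq> unit_disc"
    proof
      fix z assume "z \<in> ball a r"
      then show "z \<in> unit_disc"
        using norm_triangle_ineq[of "z - a" a] a by (simp add: dist_norm norm_minus_commute r_def)
    qed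
    have hol: "deriv f holomorphic_on ball a r"
      using an sub by (meson analytic_on_open holomorphic_deriv holomorphic_on_subset open_ball)
    \<comment> \<open>The inequality may fail at \<open>z = a\<close>, where \<open>green_disc\<close> is \<open>0\<close>, but a point is a null set.\<close>
    have mono: "AE z in lborel. ennreal c * (ennreal ((cmod (deriv f z))\<^sup>2) * indicator (ball a r) z)
        \<le> ennreal ((cmod (deriv f z))\<^sup>2 * green_disc z a powr s) * indicator unit_disc z"
      using AE_lborel_singleton[of a]
    proof eventually_elim
      case (elim z)
      show ?case
      proof (cases "z \<in> ball a r")
        case True
        then have "ln 2 \<le> green_disc z a"
          using a elim by (intro green_disc_ge_ln2) (auto simp: r_def dist_norm norm_minus_commute)
        then have "c \<le> green_disc z a powr s"
          unfolding c_def using s by (intro powr_mono2) auto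
        then have "c * (cmod (deriv f z))\<^sup>2 \<le> (cmod (deriv f z))\<^sup>2 * green_disc z a powr s"
          by (subst mult.commute) (rule mult_left_mono, auto)
        moreover have "z \<in> unit_disc" using True sub by blast
        ultimately show ?thesis
          using True c by (simp add: ennreal_mult'[symmetric])
      qed simp
    qed
    have "deriv f \<in> borel_measurable (restrict_space borel (ball a r))"
      by (intro borel_measurable_continuous_on_restrict holomorphic_on_imp_continuous_on hol)
    then have "(\<lambda>z. ennreal ((cmod (deriv f z))\<^sup>2)) \<in> borel_measurable (restrict_space borel (ball a r))"
      by measurable
    then have m: "(\<lambda>z. ennreal ((cmod (deriv f z))\<^sup>2) * indicator (ball a r) z) \<in> borel_measurable lborel"
      by (subst (asm) borel_measurable_restrict_space_iff_ennreal) auto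
    have "ennreal (c * r\<^sup>2 * (cmod (deriv f a))\<^sup>2)
        = ennreal (1 / pi) * (ennreal c * ennreal (pi * r\<^sup>2 * (cmod (deriv f a))\<^sup>2))"
      using c by (simp flip: ennreal_mult')
    also have "\<dots> \<le> ennreal (1 / pi) * (ennreal c *
        (\<integral>\<^sup>+z. ennreal ((cmod (deriv f z))\<^sup>2) * indicator (ball a r) z \<partial>lborel))"
      by (intro mult_left_mono cmod_square_le_disc_mean[OF hol r]) auto
    also have "\<dots> = ennreal (1 / pi) *
        (\<integral>\<^sup>+z. ennreal c * (ennreal ((cmod (deriv f z))\<^sup>2) * indicator (ball a r) z) \<partial>lborel)"
      by (subst nn_integral_cmult[OF m]) simp
    also have "\<dots> \<le> ennreal (1 / pi) *
        (\<integral>\<^sup>+z. ennreal ((cmod (deriv f z))\<^sup>2 * green_disc z a powr s) * indicator unit_disc z \<partial>lborel)"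
      by (intro mult_left_mono nn_integral_mono_AE mono) auto
    also have "\<dots> = J a"
      unfolding J_def by (rule nn_integral_area_measure[OF Q_integrand_measurable[OF an], symmetric])
    also have "\<dots> \<le> ennreal S" by (rule J_le[OF a])
    finally have "c * r\<^sup>2 * (cmod (deriv f a))\<^sup>2 \<le> S"
      by (subst (asm) ennreal_le_iff) (auto simp: S_def)
    then have "(cmod (deriv f a) * (1 - cmod a))\<^sup>2 \<le> 4 * S / c"
      unfolding power_mult_distrib using c by (simp add: r_def power_divide pos_le_divide_eq mult_ac)
    then have "cmod (deriv f a) * (1 - cmod a) \<le> sqrt (4 * S / c)"
      by (rule real_le_rsqrt)
    then show ?thesis
      using a by (simp add: pos_le_divide_eq)
  qed
  show thesis
  proof
    show "0 \<le> sqrt (4 * S / c)" using c by (simp add: S_def)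
  qed (rule bound)
qed

text \<open>
  Integrating the bound on the derivative from \<open>0\<close> to \<open>t\<close> gives \<open>|f(t) - f(0)| \<le> C ln (1 / (1 - t))\<close>.
  The constant \<open>|f(0)|\<close> is absorbed by the factor \<open>2\<close> inside the logarithm, which keeps it above
  \<open>ln 2\<close>.
\<close>

lemma Bloch_log_growth:
  assumes f: "f holomorphic_on unit_disc" and C: "0 \<le> C"
    and bd: "\<And>a. a \<in> unit_disc \<Longrightarrow> cmod (deriv f a) \<le> C / (1 - cmod a)"
    and t: "0 \<le> t" "t < 1"
  shows "cmod (f (of_real t)) \<le> (cmod (f 0) / ln 2 + C) * ln (2 / (1 - t))"
proof -
  have diff: "cmod (f (of_real t) - f 0) \<le> C * ln (1 / (1 - t))"
  proof (cases "t = 0")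
    case False
    \<comment> \<open>\<open>- C ln (1 - x)\<close> is an antiderivative of the bound on \<open>|f'(x)|\<close>.\<close>
    have "norm (f (of_real t) - f (of_real 0)) \<le> - C * ln (1 - t) - - C * ln (1 - 0)"
    proof (rule differentiable_bound_general[where f = "\<lambda>x. f (of_real x)" and \<phi> = "\<lambda>x. - C * ln (1 - x)"
          and f' = "\<lambda>x. deriv f (of_real x)" and \<phi>' = "\<lambda>x. C / (1 - x)"])
      show "0 < t" using t False by simp
      show "continuous_on {0..t} (\<lambda>x. f (of_real x))"
        using t by (intro continuous_on_compose2[OF holomorphic_on_imp_continuous_on[OF f]] continuous_intros) auto
      show "continuous_on {0..t} (\<lambda>x. - C * ln (1 - x))"
        using t by (intro continuous_intros) auto
    next
      fix x assume x: "0 < x" "x < t"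
      then have xd: "complex_of_real x \<in> unit_disc" using t by simp
      then have "(f has_field_derivative deriv f (of_real x)) (at (of_real x))"
        using f holomorphic_derivI open_ball by blast
      then show "((\<lambda>x. f (of_real x)) has_vector_derivative deriv f (of_real x)) (at x)"
        by (rule has_vector_derivative_real_field)
      show "((\<lambda>x. - C * ln (1 - x)) has_vector_derivative C / (1 - x)) (at x)"
        unfolding has_real_derivative_iff_has_vector_derivative[symmetric]
        using x t by (auto intro!: derivative_eq_intros)
      show "norm (deriv f (of_real x)) \<le> C / (1 - x)"
        using bd[OF xd] x by simp
    qed
    then show ?thesis
      using t by (simp add: ln_div)
  qed simp
  have l2: "ln 2 \<le> ln (2 / (1 - t))"
    using t by (subst ln_le_cancel_iff) (auto simp: field_simps)
  have "cmod (f 0) = cmod (f 0) / ln 2 * ln 2" by simp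
  also have "\<dots> \<le> cmod (f 0) / ln 2 * ln (2 / (1 - t))"
    by (intro mult_left_mono l2) auto
  finally have "cmod (f 0) \<le> cmod (f 0) / ln 2 * ln (2 / (1 - t))" .
  moreover have "C * ln (1 / (1 - t)) \<le> C * ln (2 / (1 - t))"
    using t C by (intro mult_left_mono) (auto simp: divide_right_mono)
  ultimately show ?thesis
    using diff norm_triangle_ineq2[of "f (of_real t)" "f 0"] by (simp add: algebra_simps)
qed

section \<open>Cauchy transforms of measures on the unit interval\<close>

text \<open>
  The kernel is bounded, since \<open>|1 - t z| \<ge> 1 - |z|\<close>.
\<close>

lemma integrable_Cauchy_kernel:
  fixes g :: "real \<Rightarrow> complex"
  assumes sets: "sets M = sets (restrict_space borel {0..<1})"
    and g: "integrable M g" and z: "z \<in> unit_disc"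
  shows "integrable M (\<lambda>t. g t / (1 - of_real t * z))"
proof (rule Bochner_Integration.integrable_bound)
  have sp: "space M = {0..<1}"
    using sets_eq_imp_space_eq[OF sets] by (simp add: space_restrict_space)
  have [measurable]: "(\<lambda>t. 1 - complex_of_real t * z) \<in> borel_measurable M"
    unfolding measurable_cong_sets[OF sets refl]
    by (intro borel_measurable_continuous_on_restrict continuous_intros)
  have [measurable]: "g \<in> borel_measurable M" using g by simp
  show "(\<lambda>t. g t / (1 - of_real t * z)) \<in> borel_measurable M"
    by measurable
  show "integrable M (\<lambda>t. g t / of_real (1 - cmod z))"
    using g by simp
  have "norm (g t / (1 - of_real t * z)) \<le> norm (g t / of_real (1 - cmod z))" if "t \<in> space M" for t
  proof -
    have "cmod (of_real t * z) \<le> cmod z"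
      using that sp z by (auto simp: norm_mult mult_left_le_one_le)
    then have "1 - cmod z \<le> cmod (1 - of_real t * z)"
      using norm_triangle_ineq2[of 1 "of_real t * z"] by simp
    then show ?thesis
      using z by (simp add: norm_divide frac_le del: of_real_diff)
  qed
  then show "AE t in M. norm (g t / (1 - of_real t * z)) \<le> norm (g t / of_real (1 - cmod z))"
    by (rule AE_I2)
qed

text \<open>
  Expanding the kernel into a geometric series exhibits the transform as a power series whose
  coefficients are the moments of \<open>g\<close>. The interchange of sum and integral is dominated by
  \<open>|g(t)| |z|\<^sup>n\<close>.
\<close>

lemma analytic_Cauchy_transform:
  fixes g :: "real \<Rightarrow> complex"
  assumes sets: "sets M = sets (restrict_space borel {0..<1})"
    and g: "integrable M g"
  shows "(\<lambda>z. LINT t|M. g t / (1 - of_real t * z)) analytic_on unit_disc"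
proof (rule power_series_analytic)
  fix z assume z: "z \<in> ball (0::complex) 1"
  have sp: "space M = {0..<1}"
    using sets_eq_imp_space_eq[OF sets] by (simp add: space_restrict_space)
  have [measurable]: "(\<lambda>t. complex_of_real t) \<in> borel_measurable M"
    unfolding measurable_cong_sets[OF sets refl]
    by (intro borel_measurable_continuous_on_restrict continuous_intros)
  have [measurable]: "g \<in> borel_measurable M" using g by simp
  have le: "cmod (g t * of_real t ^ n) \<le> cmod (g t)" if "t \<in> space M" for t n
    using that sp by (auto simp: norm_mult norm_power intro!: mult_left_le power_le_one)
  have int: "integrable M (\<lambda>t. g t * of_real t ^ n)" for n
    by (rule Bochner_Integration.integrable_bound[OF g]) (use le in \<open>auto intro!: AE_I2\<close>)
  have "(\<lambda>n. LINT t|M. (g t * of_real t ^ n) * z ^ n) sums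
      (LINT t|M. (\<Sum>n. (g t * of_real t ^ n) * z ^ n))"
  proof (rule sums_integral)
    show "integrable M (\<lambda>t. (g t * of_real t ^ n) * z ^ n)" for n
      using int by simp
    have tz: "summable (\<lambda>n. cmod (g t) * cmod z ^ n)" for t
      using z by (intro summable_mult summable_geometric) simp
    show "AE t in M. summable (\<lambda>n. norm ((g t * of_real t ^ n) * z ^ n))"
    proof (rule AE_I2)
      fix t assume t: "t \<in> space M"
      show "summable (\<lambda>n. norm ((g t * of_real t ^ n) * z ^ n))"
        by (rule summable_comparison_test'[OF tz[of t]])
          (use le[OF t] in \<open>simp add: norm_mult[of _ "z ^ _"] norm_power[of z] mult_right_mono\<close>)
    qed
    have "norm (LINT t|M. norm ((g t * of_real t ^ n) * z ^ n)) \<le> (LINT t|M. cmod (g t)) * cmod z ^ n" for n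
    proof -
      have "(LINT t|M. norm ((g t * of_real t ^ n) * z ^ n)) = (LINT t|M. cmod (g t * of_real t ^ n)) * cmod z ^ n"
        by (simp add: norm_mult[of _ "z ^ _"] norm_power[of z])
      also have "\<dots> \<le> (LINT t|M. cmod (g t)) * cmod z ^ n"
        by (intro mult_right_mono integral_mono le integrable_norm int g) auto
      finally show ?thesis by simp
    qed
    moreover have "summable (\<lambda>n. (LINT t|M. cmod (g t)) * cmod z ^ n)"
      using z by (intro summable_mult summable_geometric) simp
    ultimately show "summable (\<lambda>n. LINT t|M. norm ((g t * of_real t ^ n) * z ^ n))"
      by (rule summable_comparison_test'[rotated])
  qed
  also have "(LINT t|M. (\<Sum>n. (g t * of_real t ^ n) * z ^ n)) = (LINT t|M. g t / (1 - of_real t * z))"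
  proof (rule Bochner_Integration.integral_cong[OF refl])
    fix t assume "t \<in> space M"
    then have "cmod (of_real t * z) \<le> cmod z"
      using sp by (auto simp: norm_mult mult_left_le_one_le)
    then have "cmod (of_real t * z) < 1" using z by simp
    from sums_mult[OF geometric_sums[OF this], of "g t"]
    show "(\<Sum>n. (g t * of_real t ^ n) * z ^ n) = g t / (1 - of_real t * z)"
      by (simp add: power_mult_distrib mult.assoc sums_iff)
  qed
  finally show "(\<lambda>n. (LINT t|M. g t * of_real t ^ n) * (z - 0) ^ n) sums
      (LINT t|M. g t / (1 - of_real t * z))"
    by simp
qed

lemma integrable_log_growth:
  assumes M: "borel_measure_01 M"
    and fin: "(\<integral>\<^sup>+ t. ennreal (ln (2 / (1 - t))) \<partial>M) < \<infinity>"
    and f: "f holomorphic_on unit_disc" and K: "0 \<le> K"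
    and bd: "\<And>t. 0 \<le> t \<Longrightarrow> t < 1 \<Longrightarrow> cmod (f (of_real t)) \<le> K * ln (2 / (1 - t))"
  shows "integrable M (\<lambda>t. f (of_real t))"
proof (rule integrableI_bounded)
  have sets: "sets M = sets (restrict_space borel {0..<1})"
    using M by (simp add: borel_measure_01_def)
  have sp: "space M = {0..<1}"
    using sets_eq_imp_space_eq[OF sets] by (simp add: space_restrict_space)
  have "continuous_on {0..<1} (\<lambda>t. f (of_real t))"
    by (intro continuous_on_compose2[OF holomorphic_on_imp_continuous_on[OF f]] continuous_intros) auto
  then show "(\<lambda>t. f (of_real t)) \<in> borel_measurable M"
    unfolding measurable_cong_sets[OF sets refl] by (rule borel_measurable_continuous_on_restrict)
  have "continuous_on {0..<1::real} (\<lambda>t. ln (2 / (1 - t)))"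
    by (intro continuous_intros) auto
  then have [measurable]: "(\<lambda>t. ln (2 / (1 - t))) \<in> borel_measurable M"
    unfolding measurable_cong_sets[OF sets refl] by (rule borel_measurable_continuous_on_restrict)
  have "(\<integral>\<^sup>+t. ennreal (cmod (f (of_real t))) \<partial>M) \<le> (\<integral>\<^sup>+t. ennreal K * ennreal (ln (2 / (1 - t))) \<partial>M)"
  proof (rule nn_integral_mono)
    fix t assume "t \<in> space M"
    then show "ennreal (cmod (f (of_real t))) \<le> ennreal K * ennreal (ln (2 / (1 - t)))"
      using K sp by (subst ennreal_mult'[symmetric]) (auto intro!: ennreal_leI bd)
  qed
  also have "\<dots> = ennreal K * (\<integral>\<^sup>+t. ennreal (ln (2 / (1 - t))) \<partial>M)"
    by (rule nn_integral_cmult) measurable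
  also have "\<dots> < \<infinity>"
    using fin by (simp add: ennreal_mult_less_top)
  finally show "(\<integral>\<^sup>+t. ennreal (norm (f (of_real t))) \<partial>M) < \<infinity>" by simp
qed

section \<open>The logarithm belongs to a Q space\<close>

text \<open>
  The one-dimensional factor in the domination of the area integrals: its singularity of order one
  half is what \<open>1/|z|\<close> leaves to each coordinate via \<open>|z| \<ge> sqrt |x| sqrt |y|\<close>, and its decay of order
  three halves makes it integrable at infinity.
\<close>

definition sqrt_kernel :: "real \<Rightarrow> real" where
  "sqrt_kernel x = 1 / (sqrt \<bar>x\<bar> * (1 + \<bar>x\<bar>))"

lemma sqrt_kernel_measurable [measurable]: "sqrt_kernel \<in> borel_measurable borel"
  unfolding sqrt_kernel_def by measurable

lemma sqrt_kernel_nonneg: "0 \<le> sqrt_kernel x"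
  by (simp add: sqrt_kernel_def)

text \<open>
  On the positive half line the kernel has the bounded antiderivative \<open>2 arctan (sqrt x)\<close>.
\<close>

lemma nn_integral_sqrt_kernel_finite: "(\<integral>\<^sup>+x. ennreal (sqrt_kernel x) \<partial>lborel) < \<infinity>"
proof -
  let ?F = "\<lambda>x. 2 * arctan (sqrt x)"
  have "set_integrable lborel (einterval 0 \<infinity>) sqrt_kernel"
  proof (rule interval_integral_FTC_nonneg)
    show "(?F has_real_derivative sqrt_kernel x) (at x)" if "0 < ereal x" for x
    proof -
      have x: "0 < x" using that by simp
      have "(?F has_real_derivative 2 * (inverse (1 + (sqrt x)\<^sup>2) * (inverse (sqrt x) / 2))) (at x)"
        using x by (intro DERIV_cmult DERIV_chain2[OF DERIV_arctan] DERIV_real_sqrt)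
      then show ?thesis
        using x by (simp add: sqrt_kernel_def inverse_eq_divide mult.commute)
    qed
    show "isCont sqrt_kernel x" if "0 < ereal x" for x
      using that unfolding sqrt_kernel_def by (auto intro!: continuous_intros)
    show "((?F \<circ> real_of_ereal) \<longlongrightarrow> 0) (at_right 0)"
      by (auto simp: zero_ereal_def ereal_tendsto_simps intro!: tendsto_eq_intros)
    have "((\<lambda>x. arctan (sqrt x)) \<longlongrightarrow> pi / 2) at_top"
      by (rule filterlim_compose[OF tendsto_arctan_at_top sqrt_at_top])
    from tendsto_mult[OF tendsto_const[of 2] this]
    show "((?F \<circ> real_of_ereal) \<longlongrightarrow> pi) (at_left \<infinity>)"
      unfolding ereal_tendsto_simps by simp
  qed (auto simp: sqrt_kernel_nonneg)
  moreover have "einterval 0 \<infinity> = {0::real<..}"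
    by (auto simp: einterval_def)
  ultimately have "integrable lborel (\<lambda>x. indicator {0<..} x *\<^sub>R sqrt_kernel x)"
    by (simp add: set_integrable_def)
  then have "(\<integral>\<^sup>+x. ennreal (norm (indicator {0<..} x *\<^sub>R sqrt_kernel x)) \<partial>lborel) < \<infinity>"
    by (simp add: integrable_iff_bounded)
  also have "(\<integral>\<^sup>+x. ennreal (norm (indicator {0<..} x *\<^sub>R sqrt_kernel x)) \<partial>lborel)
      = (\<integral>\<^sup>+x. ennreal (sqrt_kernel x) * indicator {0<..} x \<partial>lborel)"
    by (intro nn_integral_cong) (auto simp: sqrt_kernel_nonneg split: split_indicator)
  finally have half: "(\<integral>\<^sup>+x. ennreal (sqrt_kernel x) * indicator {0<..} x \<partial>lborel) < \<infinity>" .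
  have "(\<integral>\<^sup>+x. ennreal (sqrt_kernel x) \<partial>lborel)
      = (\<integral>\<^sup>+x. ennreal (sqrt_kernel x) * indicator {0<..} x
          + ennreal (sqrt_kernel (- x)) * indicator {0<..} (- x) \<partial>lborel)"
    by (intro nn_integral_cong) (auto simp: sqrt_kernel_def split: split_indicator)
  also have "\<dots> = (\<integral>\<^sup>+x. ennreal (sqrt_kernel x) * indicator {0<..} x \<partial>lborel)
      + (\<integral>\<^sup>+x. ennreal (sqrt_kernel (- x)) * indicator {0<..} (- x) \<partial>lborel)"
    by (rule nn_integral_add) measurable
  also have "(\<integral>\<^sup>+x. ennreal (sqrt_kernel (- x)) * indicator {0<..} (- x) \<partial>lborel)
      = (\<integral>\<^sup>+x. ennreal (sqrt_kernel x) * indicator {0<..} x \<partial>lborel)"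
    using nn_integral_real_affine[of "\<lambda>x. ennreal (sqrt_kernel x) * indicator {0<..} x" "-1" 0] by simp
  finally show ?thesis
    using half by (simp add: less_top)
qed

lemma nn_integral_scaled_kernel:
  assumes [measurable]: "k \<in> borel_measurable borel" and d: "0 < d"
  shows "(\<integral>\<^sup>+x. ennreal (k ((x - b) / d) / d) \<partial>lborel) = (\<integral>\<^sup>+x. ennreal (k x) \<partial>lborel)"
proof -
  have "(\<integral>\<^sup>+x. ennreal (k ((x - b) / d) / d) \<partial>lborel)
      = ennreal d * (\<integral>\<^sup>+x. ennreal (k x / d) \<partial>lborel)"
    using d by (subst nn_integral_real_affine[of _ d b]) auto
  also have "\<dots> = (\<integral>\<^sup>+x. ennreal d * ennreal (k x / d) \<partial>lborel)"
    by (rule nn_integral_cmult[symmetric]) measurable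
  also have "\<dots> = (\<integral>\<^sup>+x. ennreal (k x) \<partial>lborel)"
    using d by (intro nn_integral_cong) (simp flip: ennreal_mult')
  finally show ?thesis .
qed

text \<open>
  The value depends neither on the centre \<open>a\<close> nor on the scale \<open>d\<close>. This is what makes the estimate of
  the \<open>Q\<^sub>2\<close> seminorm uniform in the pole.
\<close>

lemma nn_integral_product_kernel:
  assumes [measurable]: "k \<in> borel_measurable borel" and k: "\<And>x. 0 \<le> k x" and d: "0 < d"
  shows "(\<integral>\<^sup>+z. ennreal (k ((Re z - Re a) / d) / d * (k ((Im z - Im a) / d) / d)) \<partial>lborel)
    = (\<integral>\<^sup>+x. ennreal (k x) \<partial>lborel)\<^sup>2"
proof -
  have "(\<integral>\<^sup>+z. ennreal (k ((Re z - Re a) / d) / d * (k ((Im z - Im a) / d) / d)) \<partial>lborel)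
      = (\<integral>\<^sup>+x. \<integral>\<^sup>+y. ennreal (k ((x - Re a) / d) / d * (k ((y - Im a) / d) / d)) \<partial>lborel \<partial>lborel)"
    by (subst nn_integral_lborel_complex(1)) auto
  also have "\<dots> = (\<integral>\<^sup>+x. ennreal (k ((x - Re a) / d) / d) *
      (\<integral>\<^sup>+y. ennreal (k ((y - Im a) / d) / d) \<partial>lborel) \<partial>lborel)"
  proof (rule nn_integral_cong)
    fix x
    show "(\<integral>\<^sup>+y. ennreal (k ((x - Re a) / d) / d * (k ((y - Im a) / d) / d)) \<partial>lborel)
        = ennreal (k ((x - Re a) / d) / d) * (\<integral>\<^sup>+y. ennreal (k ((y - Im a) / d) / d) \<partial>lborel)"
      using k d by (subst ennreal_mult', simp, subst nn_integral_cmult) auto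
  qed
  also have "\<dots> = (\<integral>\<^sup>+x. ennreal (k ((x - Re a) / d) / d) \<partial>lborel) *
      (\<integral>\<^sup>+y. ennreal (k ((y - Im a) / d) / d) \<partial>lborel)"
    by (rule nn_integral_multc) measurable
  finally show ?thesis
    using d by (simp add: nn_integral_scaled_kernel power2_eq_square)
qed

lemma cmod_one_minus_cnj_mult_square:
  "(cmod (1 - cnj a * z))\<^sup>2 = (cmod (z - a))\<^sup>2 + (1 - (cmod a)\<^sup>2) * (1 - (cmod z)\<^sup>2)"
  by (simp add: cmod_power2) (simp add: power2_eq_square algebra_simps)

text \<open>
  Writing the logarithm through \<open>sqrt p\<close> before applying \<open>ln x \<le> x - 1\<close> leaves only the singularity
  \<open>1/p\<close> at the origin, which is integrable in the plane, while keeping the quadratic decay as \<open>p\<close>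
  approaches \<open>1\<close>. Applying it to \<open>1/p\<close> directly would give a singularity \<open>1/p\<^sup>2\<close>, which is not
  integrable.
\<close>

lemma ln_inverse_square_le:
  assumes p: "0 < p" "p \<le> (1::real)"
  shows "(ln (1 / p))\<^sup>2 \<le> 4 * (1 - p\<^sup>2)\<^sup>2 / p"
proof -
  define q where "q = sqrt p"
  have q: "0 < q" "q \<le> 1" "p = q\<^sup>2" using p by (auto simp: q_def)
  have "ln (1 / p) = 2 * ln (1 / q)"
    using q by (simp add: ln_div ln_realpow)
  also have "\<dots> \<le> 2 * (1 / q - 1)"
    using ln_le_minus_one[of "1 / q"] q by simp
  also have "\<dots> = 2 * (1 - q) / q"
    using q by (simp add: field_simps)
  also have "\<dots> \<le> 2 * (1 - p\<^sup>2) / q"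
  proof -
    \<comment> \<open>This weakening makes the bound rational in \<open>p\<^sup>2\<close>, for which there is the identity
      \<open>cmod_one_minus_cnj_mult_square\<close>.\<close>
    have "p\<^sup>2 \<le> q" unfolding q(3) using q power_decreasing[of 1 4 q] by (simp flip: power_mult)
    then show ?thesis using q by (simp add: divide_right_mono)
  qed
  finally have "(ln (1 / p))\<^sup>2 \<le> (2 * (1 - p\<^sup>2) / q)\<^sup>2"
    using p by (intro power_mono) auto
  also have "\<dots> = 4 * (1 - p\<^sup>2)\<^sup>2 / p"
    unfolding power_divide power_mult_distrib using q(3) by simp
  finally show ?thesis .
qed

text \<open>
  With \<open>p = m/w\<close> the pseudohyperbolic distance from \<open>z\<close> to \<open>a\<close>, the identity
  \<open>1 - p\<^sup>2 = d (1 - |z|\<^sup>2) / w\<^sup>2\<close> and the bound on \<open>(ln (1/p))\<^sup>2\<close> produce the factor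
  \<open>(1 - |z|\<^sup>2)\<^sup>2\<close>. It cancels \<open>1 / |1 - z|\<^sup>2\<close>, because \<open>1 - |z|\<^sup>2 \<le> 2 |1 - z|\<close>. The powers match because
  the exponent of the Green's function is \<open>2\<close>.
\<close>

lemma green_disc_kernel_bound:
  assumes a: "cmod a < 1" and z: "cmod z < 1" "z \<noteq> a"
  defines "d \<equiv> 1 - (cmod a)\<^sup>2" and "w \<equiv> cmod (1 - cnj a * z)" and "m \<equiv> cmod (z - a)"
  shows "(1 / cmod (1 - z))\<^sup>2 * green_disc z a powr 2 \<le> 16 * d\<^sup>2 / (w ^ 3 * m)"
proof -
  define e where "e = 1 - (cmod z)\<^sup>2"
  have d: "0 < d" and e: "0 < e"
    using a z by (auto simp: d_def e_def power_less_one_iff)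
  have m: "0 < m" using z by (simp add: m_def)
  have w2: "w\<^sup>2 = m\<^sup>2 + d * e"
    by (simp add: w_def m_def d_def e_def cmod_one_minus_cnj_mult_square)
  have de: "0 < d * e" using d e by simp
  have "m\<^sup>2 \<le> w\<^sup>2" using w2 de by simp
  then have mw: "m \<le> w" by (rule power2_le_imp_le) (simp add: w_def)
  then have w: "0 < w" using m by simp
  define p where "p = m / w"
  have p: "0 < p" "p \<le> 1" using m w mw by (auto simp: p_def)
  have g: "green_disc z a = ln (1 / p)"
    by (simp add: green_disc_def p_def w_def m_def norm_divide)
  have "0 \<le> green_disc z a" unfolding g using p by simp
  then have "green_disc z a powr 2 = (ln (1 / p))\<^sup>2"
    using g by (simp add: powr_numeral)
  also have "\<dots> \<le> 4 * (1 - p\<^sup>2)\<^sup>2 / p"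
    by (rule ln_inverse_square_le[OF p])
  also have "1 - p\<^sup>2 = d * e / w\<^sup>2"
  proof -
    have "d * e = w\<^sup>2 - m\<^sup>2" using w2 by simp
    then show ?thesis using w by (simp add: p_def power_divide diff_divide_distrib)
  qed
  also have "4 * (d * e / w\<^sup>2)\<^sup>2 / p = 4 * d\<^sup>2 * e\<^sup>2 / (w ^ 3 * m)"
    using w m by (simp add: p_def field_simps power2_eq_square power3_eq_cube)
  finally have G: "green_disc z a powr 2 \<le> 4 * d\<^sup>2 * e\<^sup>2 / (w ^ 3 * m)" .
  have "e = (1 - cmod z) * (1 + cmod z)"
    by (simp add: e_def power2_eq_square algebra_simps)
  also have "\<dots> \<le> cmod (1 - z) * 2"
    using z norm_triangle_ineq2[of 1 z] by (intro mult_mono) auto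
  finally have "e\<^sup>2 \<le> (cmod (1 - z) * 2)\<^sup>2"
    using e by (intro power_mono) auto
  then have "4 * d\<^sup>2 * e\<^sup>2 / (w ^ 3 * m) \<le> 4 * d\<^sup>2 * (cmod (1 - z) * 2)\<^sup>2 / (w ^ 3 * m)"
    using w m by (intro divide_right_mono mult_left_mono) auto
  with G have "green_disc z a powr 2 \<le> 4 * d\<^sup>2 * (cmod (1 - z) * 2)\<^sup>2 / (w ^ 3 * m)"
    by simp
  then have "(1 / cmod (1 - z))\<^sup>2 * green_disc z a powr 2
      \<le> (1 / cmod (1 - z))\<^sup>2 * (4 * d\<^sup>2 * (cmod (1 - z) * 2)\<^sup>2 / (w ^ 3 * m))"
    by (rule mult_left_mono) simp
  also have "\<dots> = 16 * d\<^sup>2 / (w ^ 3 * m)"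
  proof -
    have "1 - z \<noteq> 0" using z by auto
    then show ?thesis by (simp add: power_mult_distrib power_divide)
  qed
  finally show ?thesis .
qed

text \<open>
  The quantity \<open>w\<close> dominates both \<open>m\<close> and \<open>d/2\<close>, hence also \<open>(d + |x|)/3\<close> and \<open>(d + |y|)/3\<close>, where \<open>x\<close>
  and \<open>y\<close> are the coordinates of \<open>z - a\<close>. Using the three factors of \<open>w\<^sup>3\<close> for \<open>d/2\<close> and these two
  quantities, and \<open>m \<ge> sqrt |x| sqrt |y|\<close>, the variables separate; the constant is \<open>16 \<cdot> 18\<close>. The
  coordinates must be nonzero because the kernel is given the value \<open>0\<close> at its singularity.
\<close>

lemma green_disc_product_bound:
  assumes a: "cmod a < 1" and z: "cmod z < 1" "Re z \<noteq> Re a" "Im z \<noteq> Im a"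
  defines "d \<equiv> 1 - (cmod a)\<^sup>2"
  shows "(1 / cmod (1 - z))\<^sup>2 * green_disc z a powr 2
    \<le> 288 * (sqrt_kernel ((Re z - Re a) / d) / d * (sqrt_kernel ((Im z - Im a) / d) / d))"
proof -
  define w m x y where "w = cmod (1 - cnj a * z)" and "m = cmod (z - a)"
    and "x = \<bar>Re z - Re a\<bar>" and "y = \<bar>Im z - Im a\<bar>"
  have d: "0 < d" using a by (simp add: d_def power_less_one_iff)
  have x: "0 < x" and y: "0 < y" using z by (auto simp: x_def y_def)
  have xm: "x \<le> m" and ym: "y \<le> m"
    using abs_Re_le_cmod[of "z - a"] abs_Im_le_cmod[of "z - a"] by (auto simp: x_def y_def m_def)
  have "m\<^sup>2 \<le> w\<^sup>2"
    using a z d unfolding w_def m_def cmod_one_minus_cnj_mult_square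
    by (simp add: power_le_one_iff flip: d_def)
  then have mw: "m \<le> w" by (rule power2_le_imp_le) (simp add: w_def)
  have "d = (1 - cmod a) * (1 + cmod a)" by (simp add: d_def power2_eq_square algebra_simps)
  also have "\<dots> \<le> (1 - cmod a) * 2" using a by (intro mult_left_mono) auto
  also have "\<dots> \<le> w * 2"
    unfolding w_def using cmod_one_minus_cnj_mult_ge[OF a z(1)] by simp
  finally have dw: "d / 2 \<le> w" by simp
  have "sqrt x * sqrt y \<le> sqrt m * sqrt m"
    using xm ym x y by (intro mult_mono) auto
  then have sm: "sqrt x * sqrt y \<le> m" using x xm by simp
  have "d / 2 * ((d + x) / 3) * ((d + y) / 3) \<le> w * w * w"
    using d x y xm ym mw dw by (intro mult_mono) auto
  then have "d * (d + x) * (d + y) / 18 * (sqrt x * sqrt y) \<le> w ^ 3 * m"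
    using d x y xm mw by (intro mult_mono sm) (auto simp: power3_eq_cube)
  then have "16 * d\<^sup>2 / (w ^ 3 * m) \<le> 16 * d\<^sup>2 / (d * (d + x) * (d + y) / 18 * (sqrt x * sqrt y))"
    using d x y by (intro divide_left_mono mult_pos_pos) (auto simp: zero_less_mult_iff intro: less_le_trans[OF _ order_trans[OF xm mw]] less_le_trans[OF _ xm])
  also have "\<dots> = 288 * (sqrt_kernel ((Re z - Re a) / d) / d * (sqrt_kernel ((Im z - Im a) / d) / d))"
  proof -
    have sk: "sqrt_kernel (u / d) / d = sqrt d / (sqrt \<bar>u\<bar> * (d + \<bar>u\<bar>))" if "u \<noteq> 0" for u
    proof -
      have "sqrt_kernel (u / d) = sqrt d / (sqrt \<bar>u\<bar> * (1 + \<bar>u\<bar> / d))"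
        using d by (simp add: sqrt_kernel_def abs_divide real_sqrt_divide)
      also have "1 + \<bar>u\<bar> / d = (d + \<bar>u\<bar>) / d" using d by (simp add: field_simps)
      finally show ?thesis using d by simp
    qed
    have "sqrt_kernel ((Re z - Re a) / d) / d * (sqrt_kernel ((Im z - Im a) / d) / d)
        = d / ((sqrt x * (d + x)) * (sqrt y * (d + y)))"
      using z d by (simp add: sk x_def y_def)
    moreover have "16 * d\<^sup>2 / (d * X * Y / 18 * (u * v)) = 288 * (d / ((u * X) * (v * Y)))" for X Y u v
      using d by (simp add: power2_eq_square)
    ultimately show ?thesis by simp
  qed
  finally have "16 * d\<^sup>2 / (w ^ 3 * m)
      \<le> 288 * (sqrt_kernel ((Re z - Re a) / d) / d * (sqrt_kernel ((Im z - Im a) / d) / d))" .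
  moreover have "z \<noteq> a" using z by auto
  ultimately show ?thesis
    using green_disc_kernel_bound[OF a z(1)] unfolding w_def m_def d_def by (meson order_trans)
qed

lemma AE_lborel_Re_Im_neq: "AE z in lborel. Re z \<noteq> Re a \<and> Im z \<noteq> Im a"
proof -
  have "negligible {z::complex. 1 \<bullet> z = Re a}" "negligible {z::complex. \<i> \<bullet> z = Im a}"
    by (intro negligible_hyperplane; simp)+
  then have "{z. Re z = Re a} \<in> null_sets lebesgue" "{z. Im z = Im a} \<in> null_sets lebesgue"
    by (auto simp: negligible_iff_null_sets inner_complex_def)
  moreover have "{z. Re z = Re a} \<in> sets borel" "{z. Im z = Im a} \<in> sets borel"
    by measurable
  ultimately have "{z. Re z = Re a} \<in> null_sets lborel" "{z. Im z = Im a} \<in> null_sets lborel"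
    by (auto simp: null_sets_completion_iff)
  from this[THEN AE_not_in] show ?thesis
    by eventually_elim simp
qed

text \<open>
  The summand \<open>ln 2\<close> makes the restriction to \<open>[0,1)\<close> equal to \<open>ln (2 / (1 - t))\<close>, the integrand of
  condition (i).
\<close>

lemma log_in_Q_space_2: "(\<lambda>z. of_real (ln 2) - Ln (1 - z)) \<in> Q_space 2"
proof -
  let ?f = "\<lambda>z. complex_of_real (ln 2) - Ln (1 - z)"
  define K where "K = (\<integral>\<^sup>+x. ennreal (sqrt_kernel x) \<partial>lborel)"
  have K: "K < \<infinity>" unfolding K_def by (rule nn_integral_sqrt_kernel_finite)
  have nonpos: "1 - z \<notin> \<real>\<^sub>\<le>\<^sub>0" if "z \<in> unit_disc" for z
    using that complex_Re_le_cmod[of z] by (auto simp: complex_nonpos_Reals_iff)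
  have dv: "(?f has_field_derivative 1 / (1 - z)) (at z)" if "z \<in> unit_disc" for z
    using nonpos[OF that] by (auto intro!: derivative_eq_intros simp: field_simps)
  have an: "?f analytic_on unit_disc"
    unfolding analytic_on_open[OF open_ball] holomorphic_on_open[OF open_ball] using dv by blast
  have bound: "(\<integral>\<^sup>+z. ennreal ((cmod (deriv ?f z))\<^sup>2 * green_disc z a powr 2) \<partial>area_measure)
      \<le> ennreal (1 / pi) * (288 * K\<^sup>2)" if a: "a \<in> unit_disc" for a
  proof -
    define d where "d = 1 - (cmod a)\<^sup>2"
    have d: "0 < d" using a by (simp add: d_def power_less_one_iff)
    define P where "P = (\<lambda>z. sqrt_kernel ((Re z - Re a) / d) / d * (sqrt_kernel ((Im z - Im a) / d) / d))"
    have [measurable]: "P \<in> borel_measurable borel" unfolding P_def by measurable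
    have "AE z in lborel. ennreal ((cmod (deriv ?f z))\<^sup>2 * green_disc z a powr 2) * indicator unit_disc z
        \<le> 288 * ennreal (P z)"
      using AE_lborel_Re_Im_neq[of a]
    proof eventually_elim
      case (elim z)
      show ?case
      proof (cases "z \<in> unit_disc")
        case True
        have "(cmod (deriv ?f z))\<^sup>2 * green_disc z a powr 2 \<le> 288 * P z"
          using green_disc_product_bound[of a z] True a elim DERIV_imp_deriv[OF dv[OF True]]
          by (simp add: P_def d_def norm_divide)
        then have "ennreal ((cmod (deriv ?f z))\<^sup>2 * green_disc z a powr 2) \<le> ennreal (288 * P z)"
          by (rule ennreal_leI)
        then show ?thesis using True by (simp add: ennreal_mult'[of 288])
      qed simp
    qed
    then have "(\<integral>\<^sup>+z. ennreal ((cmod (deriv ?f z))\<^sup>2 * green_disc z a powr 2) * indicator unit_disc z \<partial>lborel)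
        \<le> (\<integral>\<^sup>+z. 288 * ennreal (P z) \<partial>lborel)"
      by (rule nn_integral_mono_AE)
    also have "\<dots> = 288 * (\<integral>\<^sup>+z. ennreal (P z) \<partial>lborel)"
      by (rule nn_integral_cmult) measurable
    also have "(\<integral>\<^sup>+z. ennreal (P z) \<partial>lborel) = K\<^sup>2"
      unfolding P_def K_def
      by (rule nn_integral_product_kernel[OF sqrt_kernel_measurable sqrt_kernel_nonneg d])
    finally show ?thesis
      by (subst nn_integral_area_measure[OF Q_integrand_measurable[OF an]]) (intro mult_left_mono, auto)
  qed
  have "ennreal (1 / pi) * (288 * K\<^sup>2) < \<infinity>"
    using K by (simp add: ennreal_mult_less_top power2_eq_square)
  with SUP_least[of unit_disc, OF bound]
  have "(SUP a\<in>unit_disc. \<integral>\<^sup>+z. ennreal ((cmod (deriv ?f z))\<^sup>2 * green_disc z a powr 2) \<partial>area_measure) < \<infinity>"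
    by (rule le_less_trans)
  with an show ?thesis
    unfolding Q_space_iff by (rule conjI)
qed

section \<open>The equivalence\<close>

theorem theorem3p1:
  fixes \<mu> :: "real measure"
  assumes "borel_measure_01 \<mu>"
  shows "(\<integral>\<^sup>+ t. ennreal (ln (2 / (1 - t))) \<partial>\<mu>) < \<infinity> \<longleftrightarrow>
    (\<forall>s>0. \<forall>f\<in>Q_space s.
       (\<forall>z\<in>unit_disc. integrable \<mu> (I_integrand f z)) \<and> I_op \<mu> f analytic_on unit_disc)"
proof (intro iffI allI impI ballI)
  fix s :: real and f
  assume fin: "(\<integral>\<^sup>+ t. ennreal (ln (2 / (1 - t))) \<partial>\<mu>) < \<infinity>" and s: "0 < s" and f: "f \<in> Q_space s"
  have sets: "sets \<mu> = sets (restrict_space borel {0..<1})"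
    using assms by (simp add: borel_measure_01_def)
  have hol: "f holomorphic_on unit_disc"
    using f by (simp add: Q_space_def analytic_on_open)
  obtain C where C: "0 \<le> C" "\<And>a. a \<in> unit_disc \<Longrightarrow> cmod (deriv f a) \<le> C / (1 - cmod a)"
    using Q_space_imp_Bloch[OF f s] by metis
  have "0 \<le> cmod (f 0) / ln 2 + C" using C(1) by simp
  then have int: "integrable \<mu> (\<lambda>t. f (of_real t))"
    using Bloch_log_growth[OF hol C] by (rule integrable_log_growth[OF assms fin hol])
  show "(\<forall>z\<in>unit_disc. integrable \<mu> (I_integrand f z)) \<and> I_op \<mu> f analytic_on unit_disc"
    unfolding I_op_def[abs_def] I_integrand_def[abs_def]
    using integrable_Cauchy_kernel[OF sets int] analytic_Cauchy_transform[OF sets int] by blast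
next
  let ?f = "\<lambda>z. complex_of_real (ln 2) - Ln (1 - z)"
  assume "\<forall>s>0. \<forall>f\<in>Q_space s.
       (\<forall>z\<in>unit_disc. integrable \<mu> (I_integrand f z)) \<and> I_op \<mu> f analytic_on unit_disc"
  then have "integrable \<mu> (I_integrand ?f 0)"
    using log_in_Q_space_2 by (meson centre_in_ball zero_less_numeral zero_less_one)
  then have "(\<integral>\<^sup>+ t. ennreal (cmod (I_integrand ?f 0 t)) \<partial>\<mu>) < \<infinity>"
    by (simp add: integrable_iff_bounded)
  also have "(\<integral>\<^sup>+ t. ennreal (cmod (I_integrand ?f 0 t)) \<partial>\<mu>) = (\<integral>\<^sup>+ t. ennreal (ln (2 / (1 - t))) \<partial>\<mu>)"
  proof (rule nn_integral_cong)
    fix t assume "t \<in> space \<mu>"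
    moreover have "space \<mu> = {0..<1}"
      using sets_eq_imp_space_eq[of \<mu> "restrict_space borel {0..<1}"] assms
      by (simp add: borel_measure_01_def space_restrict_space)
    ultimately have t: "0 \<le> t" "t < 1" by auto
    have "Ln (1 - complex_of_real t) = of_real (ln (1 - t))"
      using Ln_of_real[of "1 - t"] t by simp
    then have "I_integrand ?f 0 t = of_real (ln (2 / (1 - t)))"
      using t by (simp add: I_integrand_def ln_div)
    moreover have "0 \<le> ln (2 / (1 - t))" using t by simp
    ultimately show "ennreal (cmod (I_integrand ?f 0 t)) = ennreal (ln (2 / (1 - t)))"
      by (simp only: norm_of_real abs_of_nonneg)
  qed
  finally show "(\<integral>\<^sup>+ t. ennreal (ln (2 / (1 - t))) \<partial>\<mu>) < \<infinity>" .
qed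

end
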